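(* Let $m\ge1$, $b\ge2$ and $d\ge2$ be integers, and let $\pi_1,\dots,\pi_d$ be permutations of $\{1,\dots,m\}$, not necessarily distinct. Put $n=b^m$, and for $i=0,\dots,n-1$ and $k=1,\dots,m$ define the digits $a_{i,k}\in\{0,1,\dots,b-1\}$ by $i=\sum_{k=1}^m a_{i,k}b^{k-1}$. Let $\boldsymbol{x}_i\in(0,1]^d$ have components $$x_{ij}=\frac1n+\sum_{k=1}^m b^{-k}a_{i,\pi_j(k)},\qquad j=1,\dots,d.$$ Then for every $\boldsymbol{z}\in[0,1]^d$, $$\frac1n\sum_{i=0}^{n-1}\prod_{j=1}^d \mathbb{1}\{x_{ij}>1-z_j\}\ \ge\ \prod_{j=1}^d z_j .$$
   Context: $\mathbb{1}\{A\}$ equals $1$ if $A$ is true and $0$ otherwise. *)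

theory Defs
  imports Complex_Main "HOL-Combinatorics.Permutations"
begin

end

theory Submission
  imports Defs "HOL-Library.FuncSet"
begin

text \<open>
  For uniformly distributed \<open>i\<close> the digit vector of \<open>i\<close> is uniform on the product of \<open>m\<close> chains, and
  each event \<open>x\<^sub>i\<^sub>j > 1 - z\<^sub>j\<close> is increasing in the digits. By Harris' inequality these events are
  positively correlated. Permuting the digits preserves the uniform distribution, so
  \<open>n x\<^sub>i\<^sub>j\<close> is uniform on \<open>{1, \<dots>, n}\<close> and each single event has probability at least \<open>z\<^sub>j\<close>.
\<close>

lemma sum_PiE_insert:
  fixes f :: "('a \<Rightarrow> 'b) \<Rightarrow> real"
  assumes "k \<notin> S"
  shows "sum f (PiE (insert k S) A) = (\<Sum>c\<in>A k. \<Sum>w\<in>PiE S A. f (w(k := c)))"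
proof -
  have inj: "inj_on (\<lambda>(c, w). w(k := c)) (A k \<times> PiE S A)"
    using assms by (rule inj_combinator)
  have "sum f (PiE (insert k S) A) = (\<Sum>(c, w)\<in>A k \<times> PiE S A. f (w(k := c)))"
    unfolding PiE_insert_eq by (subst sum.reindex[OF inj]) (simp add: case_prod_beta)
  then show ?thesis
    by (simp add: sum.cartesian_product)
qed

lemma mono_on_fun_upd_PiE:
  fixes f :: "('a \<Rightarrow> nat) \<Rightarrow> real"
  assumes "mono_on (PiE (insert k S) A) f" and "c \<in> A k"
  shows "mono_on (PiE S A) (\<lambda>w. f (w(k := c)))"
proof (rule mono_onI)
  fix u v assume "u \<in> PiE S A" "v \<in> PiE S A" "u \<le> v"
  then show "f (u(k := c)) \<le> f (v(k := c))"
    using assms(2) by (intro mono_onD[OF assms(1)] PiE_fun_upd) (auto simp: le_fun_def)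
qed

text \<open>Induction on the coordinates. Summing out all coordinates but one leaves two increasing
  functions of a single variable, to which Chebyshev's sum inequality applies; the induction
  hypothesis then bounds each slice. Working with sums instead of means puts the normalising power
  of \<open>b\<close> on the right.\<close>

lemma Harris_inequality:
  fixes f g :: "('a \<Rightarrow> nat) \<Rightarrow> real"
  assumes "finite S"
    and "mono_on (PiE S (\<lambda>_. {..<b})) f" and "mono_on (PiE S (\<lambda>_. {..<b})) g"
  shows "sum f (PiE S (\<lambda>_. {..<b})) * sum g (PiE S (\<lambda>_. {..<b}))
    \<le> real b ^ card S * (\<Sum>v\<in>PiE S (\<lambda>_. {..<b}). f v * g v)"
  using assms
proof (induction S arbitrary: f g rule: finite_induct)
  case empty
  then show ?case by simp
next
  case (insert k S)
  let ?P = "PiE S (\<lambda>_. {..<b})"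
  define F where "F h c = (\<Sum>w\<in>?P. h (w(k := c)))" for h :: "('a \<Rightarrow> nat) \<Rightarrow> real" and c
  have sum_eq: "sum h (PiE (insert k S) (\<lambda>_. {..<b})) = (\<Sum>c=0..<b. F h c)" for h
    using sum_PiE_insert[OF insert.hyps(2), of h "\<lambda>_. {..<b}"]
    by (simp add: F_def lessThan_atLeast0)
  have F_mono: "F h c \<le> F h c'"
    if h: "mono_on (PiE (insert k S) (\<lambda>_. {..<b})) h" and c: "c \<le> c'" "c' < b" for h c c'
    unfolding F_def
  proof (intro sum_mono mono_onD[OF h])
    fix w assume w: "w \<in> ?P"
    show "w(k := c) \<in> PiE (insert k S) (\<lambda>_. {..<b})" "w(k := c') \<in> PiE (insert k S) (\<lambda>_. {..<b})"
      using w c by (auto intro!: PiE_fun_upd)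
    show "w(k := c) \<le> w(k := c')"
      using c by (simp add: le_fun_def)
  qed
  \<comment> \<open>\<open>Chebyshev_sum_upper\<close> pairs an increasing with a decreasing
    sequence, so \<open>F g\<close> enters with a minus sign.\<close>
  have "real b * (\<Sum>c=0..<b. F f c * (- F g c)) \<le> (\<Sum>c=0..<b. F f c) * (\<Sum>c=0..<b. - F g c)"
    by (rule Chebyshev_sum_upper) (use F_mono insert.prems in auto)
  then have "(\<Sum>c=0..<b. F f c) * (\<Sum>c=0..<b. F g c) \<le> real b * (\<Sum>c=0..<b. F f c * F g c)"
    by (simp add: sum_negf)
  \<comment> \<open>The induction hypothesis is applied for each fixed \<open>c\<close> to the
    slices \<open>w(k := c)\<close>, on which \<open>f\<close> and \<open>g\<close> remain
    monotone.\<close>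
  also have "\<dots> \<le> real b * (\<Sum>c=0..<b. real b ^ card S * F (\<lambda>v. f v * g v) c)"
    unfolding F_def
    by (intro mult_left_mono sum_mono insert.IH mono_on_fun_upd_PiE insert.prems) auto
  also have "\<dots> = real b ^ card (insert k S) * (\<Sum>c=0..<b. F (\<lambda>v. f v * g v) c)"
    using insert.hyps by (simp add: sum_distrib_left mult.assoc)
  finally show ?case
    by (simp add: sum_eq)
qed

text \<open>Induction on \<open>J\<close>: a product of nonnegative increasing functions is again
  increasing, so the two-function inequality applies to \<open>f i\<close> and the product of the
  others. Nonnegativity also allows the induction hypothesis to be multiplied by the mean of
  \<open>f i\<close>.\<close>

lemma Harris_inequality_prod:
  fixes f :: "'i \<Rightarrow> ('a \<Rightarrow> nat) \<Rightarrow> real"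
  assumes S: "finite S" and b: "b > 0" and J: "finite J"
    and mono: "\<And>j. j \<in> J \<Longrightarrow> mono_on (PiE S (\<lambda>_. {..<b})) (f j)"
    and nonneg: "\<And>j v. j \<in> J \<Longrightarrow> 0 \<le> f j v"
  shows "(\<Prod>j\<in>J. sum (f j) (PiE S (\<lambda>_. {..<b})) / real b ^ card S)
    \<le> (\<Sum>v\<in>PiE S (\<lambda>_. {..<b}). \<Prod>j\<in>J. f j v) / real b ^ card S"
  using J mono nonneg
proof (induction J rule: finite_induct)
  case empty
  then show ?case using S b by (simp add: card_PiE)
next
  case (insert i J)
  let ?P = "PiE S (\<lambda>_. {..<b})" and ?N = "real b ^ card S"
  have mono': "mono_on ?P (\<lambda>v. \<Prod>j\<in>J. f j v)"
  proof (rule mono_onI)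
    fix u v assume uv: "u \<in> ?P" "v \<in> ?P" "u \<le> v"
    have "f j u \<le> f j v" if "j \<in> J" for j
      using mono_onD[OF insert.prems(1) uv] that by simp
    then show "(\<Prod>j\<in>J. f j u) \<le> (\<Prod>j\<in>J. f j v)"
      using insert.prems(2) by (simp add: prod_mono)
  qed
  have "(\<Prod>j\<in>insert i J. sum (f j) ?P / ?N) = sum (f i) ?P / ?N * (\<Prod>j\<in>J. sum (f j) ?P / ?N)"
    using insert.hyps by simp
  also have "\<dots> \<le> sum (f i) ?P / ?N * ((\<Sum>v\<in>?P. \<Prod>j\<in>J. f j v) / ?N)"
  proof (rule mult_left_mono)
    show "0 \<le> sum (f i) ?P / ?N"
      using insert.prems(2) by (simp add: sum_nonneg)
  qed (use insert.IH insert.prems in simp)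
  also have "\<dots> \<le> (\<Sum>v\<in>?P. f i v * (\<Prod>j\<in>J. f j v)) / ?N"
    using Harris_inequality[OF S insert.prems(1)[of i] mono'] b
    by (simp add: field_simps)
  finally show ?case
    using insert.hyps by simp
qed

text \<open>Composition with \<open>inv \<sigma>\<close> is the inverse map. Since
  \<open>\<sigma>\<close> fixes every point outside \<open>S\<close>, composition keeps the value
  \<open>undefined\<close> there.\<close>

lemma bij_betw_comp_permutes_PiE:
  assumes \<sigma>: "\<sigma> permutes S"
  shows "bij_betw (\<lambda>v. v \<circ> \<sigma>) (PiE S (\<lambda>_. B)) (PiE S (\<lambda>_. B))"
proof -
  have "v \<circ> \<tau> \<in> PiE S (\<lambda>_. B)" if "v \<in> PiE S (\<lambda>_. B)" "\<tau> permutes S" for v \<tau>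
    using that permutes_in_image[OF that(2)] by (auto simp: PiE_iff extensional_def)
  then show ?thesis
    using \<sigma> permutes_inv[OF \<sigma>]
    by (intro bij_betwI[where g = "\<lambda>v. v \<circ> inv \<sigma>"])
       (auto simp: comp_assoc permutes_inv_o)
qed

text \<open>Count the complement: the indicator vanishes exactly when \<open>u + 1\<close> is at
  most \<open>n (1 - z)\<close>, which happens for at most the floor of that number many
  \<open>u\<close>.\<close>

lemma card_fraction_gt_ge:
  fixes z :: real
  assumes "n > 0" and "z \<le> 1"
  shows "z * real n \<le> (\<Sum>u<n. of_bool (real (Suc u) / real n > 1 - z))"
proof -
  let ?r = "real n * (1 - z)"
  let ?L = "{u. u < n \<and> real (Suc u) \<le> ?r}"
  have "(\<Sum>u<n. of_bool (real (Suc u) / real n > 1 - z) :: real) = (\<Sum>u<n. 1 - of_bool (real (Suc u) \<le> ?r))"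
    using assms by (intro sum.cong) (auto simp: field_simps not_le)
  also have "\<dots> = real n - real (card ?L)"
    by (simp add: sum_subtractf Int_def)
  finally have eq: "(\<Sum>u<n. of_bool (real (Suc u) / real n > 1 - z)) = real n - real (card ?L)" .
  have "?L \<subseteq> {..<nat \<lfloor>?r\<rfloor>}"
  proof
    fix u assume "u \<in> ?L"
    then have "int (Suc u) \<le> \<lfloor>?r\<rfloor>" by (simp add: le_floor_iff)
    then show "u \<in> {..<nat \<lfloor>?r\<rfloor>}" by simp
  qed
  then have "card ?L \<le> nat \<lfloor>?r\<rfloor>"
    using card_mono[of "{..<nat \<lfloor>?r\<rfloor>}" ?L] by simp
  also have "real (nat \<lfloor>?r\<rfloor>) \<le> ?r"
    using assms by (simp add: of_nat_floor)
  finally show ?thesis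
    using eq by (simp add: algebra_simps)
qed

text \<open>In \<open>n\<close> times the component, digit position \<open>k\<close> has weight
  \<open>b ^ (m - k)\<close>, whereas in the expansion of an integer it has weight
  \<open>b ^ (k - 1)\<close>. This reflection exchanges the two weightings.\<close>

lemma reflection_permutes: "(\<lambda>k::nat. if k \<in> {1..m} then Suc m - k else k) permutes {1..m}"
  by (rule bij_imp_permutes)
     (auto intro!: bij_betwI[where g = "\<lambda>k. Suc m - k"] split: if_splits)

theorem theorem2:
  fixes m b d n :: nat
    and \<pi> :: "nat \<Rightarrow> nat \<Rightarrow> nat"
    and a :: "nat \<Rightarrow> nat \<Rightarrow> nat"
    and x :: "nat \<Rightarrow> nat \<Rightarrow> real"
    and z :: "nat \<Rightarrow> real"
  assumes m: "m \<ge> 1" and b: "b \<ge> 2" and d: "d \<ge> 2"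
    and perm: "\<And>j. j \<in> {1..d} \<Longrightarrow> \<pi> j permutes {1..m}"
    and n: "n = b ^ m"
    and digit: "\<And>i k. i < n \<Longrightarrow> k \<in> {1..m} \<Longrightarrow> a i k \<in> {0..b - 1}"
    and expansion: "\<And>i. i < n \<Longrightarrow> i = (\<Sum>k=1..m. a i k * b ^ (k - 1))"
    and x: "\<And>i j. i < n \<Longrightarrow> j \<in> {1..d} \<Longrightarrow>
      x i j = 1 / real n + (\<Sum>k=1..m. real (a i (\<pi> j k)) / real b ^ k)"
    and z: "\<And>j. j \<in> {1..d} \<Longrightarrow> z j \<in> {0..1}"
  shows "1 / real n * (\<Sum>i<n. \<Prod>j=1..d. of_bool (x i j > 1 - z j)) \<ge> (\<Prod>j=1..d. z j)"
proof -
  have n0: "n > 0" using b n by simp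
  let ?P = "PiE {1..m} (\<lambda>_. {..<b})"
  \<comment> \<open>\<open>D\<close> takes an index to its digit vector, restricted so as to lie in
    the extensional space \<open>?P\<close>; \<open>T\<close> evaluates a digit vector, and
    \<open>f j\<close> is the \<open>j\<close>-th event seen as a function of the digits.\<close>
  define D where "D i = restrict (a i) {1..m}" for i
  define T where "T v = (\<Sum>k=1..m. v k * b ^ (k - 1))" for v :: "nat \<Rightarrow> nat"
  define R where "R k = (if k \<in> {1..m} then Suc m - k else k)" for k
  define f :: "nat \<Rightarrow> (nat \<Rightarrow> nat) \<Rightarrow> real"
    where "f j v = of_bool (real (Suc (T (v \<circ> (\<pi> j \<circ> R)))) / real n > 1 - z j)" for j v
  have T_D: "T (D i) = i" if "i < n" for i
    using expansion[OF that] by (simp add: T_def D_def)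
  have inj: "inj_on D {..<n}"
    by (rule inj_on_inverseI[of _ T]) (use T_D in auto)
  have "D ` {..<n} \<subseteq> ?P"
    using digit b by (fastforce simp: D_def)
  \<comment> \<open>Surjectivity comes from counting: an injective image with \<open>b ^ m\<close>
    elements fills \<open>?P\<close>.\<close>
  moreover have "card (D ` {..<n}) = card ?P"
    using card_image[OF inj] n by (simp add: card_PiE)
  ultimately have "D ` {..<n} = ?P"
    by (intro card_subset_eq finite_PiE) auto
  with inj have bij_D: "bij_betw D {..<n} ?P"
    by (simp add: bij_betw_def)
  have "T ` ?P = {..<n}" "inj_on T ?P"
    using T_D unfolding bij_betw_imp_surj_on[OF bij_D, symmetric]
    by (auto simp: image_image intro!: inj_onI)
  then have bij_T: "bij_betw T ?P {..<n}"
    by (simp add: bij_betw_def)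
  have R: "R permutes {1..m}"
    using reflection_permutes[of m] by (simp add: R_def[abs_def])
  have perm': "\<pi> j \<circ> R permutes {1..m}" if "j \<in> {1..d}" for j
    using permutes_compose[OF R perm[OF that]] .
  have bij_R: "bij_betw (\<lambda>k. Suc m - k) {1..m} {1..m}"
    by (rule bij_betwI[where g = "\<lambda>k. Suc m - k"]) auto
  \<comment> \<open>The successor accounts for the shift \<open>1 / n\<close> in the definition of
    the points.\<close>
  have x_eq: "x i j = real (Suc (T (D i \<circ> (\<pi> j \<circ> R)))) / real n"
    if i: "i < n" and j: "j \<in> {1..d}" for i j
  proof -
    have "real (T (D i \<circ> (\<pi> j \<circ> R))) = (\<Sum>k=1..m. real (D i (\<pi> j (Suc m - k)) * b ^ (k - 1)))"
      by (simp add: T_def R_def)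
    also have "\<dots> = (\<Sum>k=1..m. real (D i (\<pi> j k) * b ^ (m - k)))"
      by (rule sum.reindex_bij_betw[OF bij_R, symmetric, THEN trans]) (intro sum.cong, auto)
    also have "\<dots> = (\<Sum>k=1..m. real n * (real (a i (\<pi> j k)) / real b ^ k))"
    proof (rule sum.cong)
      fix k assume k: "k \<in> {1..m}"
      then have "real n = real b ^ (m - k) * real b ^ k"
        by (simp add: n flip: power_add)
      moreover have "D i (\<pi> j k) = a i (\<pi> j k)"
        using k permutes_in_image[OF perm[OF j], of k] by (simp add: D_def del: atLeastAtMost_iff)
      ultimately show "real (D i (\<pi> j k) * b ^ (m - k)) = real n * (real (a i (\<pi> j k)) / real b ^ k)"
        using b by simp
    qed simp
    also have "\<dots> = real n * (\<Sum>k=1..m. real (a i (\<pi> j k)) / real b ^ k)"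
      by (simp add: sum_distrib_left)
    finally show ?thesis
      using x[OF i j] n0 by (simp add: field_simps)
  qed
  have mono: "mono_on ?P (f j)" for j
  proof (rule mono_onI)
    fix u v :: "nat \<Rightarrow> nat" assume "u \<le> v"
    then have "T (u \<circ> (\<pi> j \<circ> R)) \<le> T (v \<circ> (\<pi> j \<circ> R))"
      unfolding T_def by (intro sum_mono mult_right_mono) (auto simp: le_fun_def)
    then have "real (Suc (T (u \<circ> (\<pi> j \<circ> R)))) / real n \<le> real (Suc (T (v \<circ> (\<pi> j \<circ> R)))) / real n"
      by (intro divide_right_mono) auto
    then show "f j u \<le> f j v"
      by (auto simp: f_def)
  qed
  have marginal: "z j \<le> sum (f j) ?P / real b ^ card {1..m}" if j: "j \<in> {1..d}" for j
  proof -
    \<comment> \<open>Permuting the digits and then evaluating is a bijection onto the integers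
      below \<open>n\<close>, so the marginal sum is the count bounded in
      \<open>card_fraction_gt_ge\<close>.\<close>
    have "bij_betw (T \<circ> (\<lambda>v. v \<circ> (\<pi> j \<circ> R))) ?P {..<n}"
      using bij_betw_trans[OF bij_betw_comp_permutes_PiE[OF perm'[OF j]] bij_T] .
    then have "sum (f j) ?P = (\<Sum>u<n. of_bool (real (Suc u) / real n > 1 - z j))"
      using sum.reindex_bij_betw[of _ ?P "{..<n}" "\<lambda>u. of_bool (real (Suc u) / real n > 1 - z j) :: real"]
      by (simp add: f_def[abs_def] o_def)
    then show ?thesis
      using card_fraction_gt_ge[OF n0, of "z j"] z[OF j] n n0 by (simp add: field_simps)
  qed
  have "(\<Prod>j=1..d. z j) \<le> (\<Prod>j=1..d. sum (f j) ?P / real b ^ card {1..m})"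
    using z marginal by (intro prod_mono) auto
  also have "\<dots> \<le> (\<Sum>v\<in>?P. \<Prod>j=1..d. f j v) / real b ^ card {1..m}"
    using b mono by (intro Harris_inequality_prod) (auto simp: f_def)
  \<comment> \<open>The sum over digit vectors is transported back to the indices \<open>i\<close>
    along \<open>D\<close>.\<close>
  also have "\<dots> = (\<Sum>i<n. \<Prod>j=1..d. f j (D i)) / real n"
    unfolding sum.reindex_bij_betw[OF bij_D, symmetric] by (simp add: n)
  also have "\<dots> = (\<Sum>i<n. \<Prod>j=1..d. of_bool (x i j > 1 - z j)) / real n"
    by (intro arg_cong[where f = "\<lambda>s. s / real n"] sum.cong prod.cong refl)
       (simp add: f_def x_eq)
  finally show ?thesis
    by simp
qed

end
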